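(* Let $m,n\in\mathbb{N}$ and let $P(\lambda)= I\lambda^m+A_{m-1}\lambda^{m-1}+\cdots+A_1\lambda+A_0$, where $I$ is the $n\times n$ identity matrix and $A_0,\dots,A_{m-1}$ are pairwise commuting $n\times n$ complex Schur stable matrices. If $\lambda_0 \in \mathbb{C}$ is an eigenvalue of $P(\lambda)$, then $|\lambda_0|<2$.
   Context: $\mathbb{N}=\{1,2,3,\dots\}$. A square complex matrix is Schur stable if all its eigenvalues have modulus less than $1$. For a matrix polynomial $P(\lambda)=\sum_{i=0}^{m}A_i\lambda^i$ with $A_i\in M_n(\mathbb{C})$, a scalar $\lambda_0\in\mathbb{C}$ is an eigenvalue of $P(\lambda)$ if $P(\lambda_0)v=0$ for some nonzero vector $v\in\mathbb{C}^n$; equivalently, $\det P(\lambda_0)=0$. *)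

theory Defs
  imports "Jordan_Normal_Form.Char_Poly"
begin

definition schur_stable :: "complex mat \<Rightarrow> bool" where
  "schur_stable A \<longleftrightarrow> square_mat A \<and> (\<forall>k. eigenvalue A k \<longrightarrow> cmod k < 1)"

text \<open>
  The value \<open>P(z)\<close> of \<open>P(\<lambda>) = (\<Sum>i\<le>m. A i \<lambda>\<^sup>i)\<close> with \<open>n \<times> n\<close> coefficients \<open>A 0, \<dots>, A m\<close>.
  The type of matrices is not a monoid (the dimension is not part of the type),
  so the sum is written entrywise; values \<open>A i\<close> with \<open>i > m\<close> are irrelevant.
\<close>

definition matpoly_eval :: "nat \<Rightarrow> nat \<Rightarrow> (nat \<Rightarrow> complex mat) \<Rightarrow> complex \<Rightarrow> complex mat" where
  "matpoly_eval n m A z = mat n n (\<lambda>(r, c). \<Sum>i\<le>m. (z ^ i \<cdot>\<^sub>m A i) $$ (r, c))"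

definition matpoly_eigenvalue :: "nat \<Rightarrow> nat \<Rightarrow> (nat \<Rightarrow> complex mat) \<Rightarrow> complex \<Rightarrow> bool" where
  "matpoly_eigenvalue n m A z \<longleftrightarrow>
     (\<exists>v \<in> carrier_vec n. v \<noteq> 0\<^sub>v n \<and> matpoly_eval n m A z *\<^sub>v v = 0\<^sub>v n)"

end

theory Submission
  imports Defs "Jordan_Normal_Form.Schur_Decomposition"
begin

text \<open>
  The coefficients commute with each other, hence with \<open>P(z\<^sub>0)\<close>, so the nonzero space
  \<open>ker P(z\<^sub>0)\<close> is invariant under all of them and contains a common eigenvector \<open>w\<close>
  (\<open>commuting_matrices_common_eigenvector\<close>). On \<open>w\<close> the matrix equation
  \<open>P(z\<^sub>0) w = 0\<close> becomes the scalar equation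
  \<open>z\<^sub>0\<^sup>m + c\<^bsub>m-1\<^esub> z\<^sub>0\<^bsup>m-1\<^esup> + \<dots> + c\<^sub>0 = 0\<close>, where \<open>c\<^sub>i\<close> is the eigenvalue of \<open>A i\<close> at \<open>w\<close>.
  Schur stability gives \<open>\<bar>c\<^sub>i\<bar> < 1\<close>, and a monic polynomial whose lower coefficients lie in the
  unit disc has all its roots in the disc of radius 2 (\<open>monic_root_norm_less_2\<close>): for
  \<open>\<bar>z\<bar> \<ge> 2\<close> the leading term exceeds the geometric sum that bounds the others.

  Invariant subspaces are represented by predicates \<open>W\<close> on vectors that are closed under
  \<open>w \<mapsto> A w - \<mu> w\<close>. Maps of this form suffice to reach an eigenvector inside \<open>W\<close>: when \<open>\<mu>\<close>
  runs through the diagonal of a triangular form of \<open>A\<close>, they shrink any vector to \<open>0\<close>, and the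
  last nonzero vector on the way is an eigenvector.
\<close>

lemma monic_root_norm_less_2:
  fixes z :: "'a :: real_normed_field"
  assumes root: "z ^ m + (\<Sum>i<m. c i * z ^ i) = 0"
    and c: "\<And>i. i < m \<Longrightarrow> norm (c i) \<le> 1"
  shows "norm z < 2"
proof (rule ccontr)
  assume "\<not> norm z < 2"
  hence x: "norm z - 1 \<ge> 1" by simp
  let ?S = "\<Sum>i<m. norm z ^ i"
  have "z ^ m = - (\<Sum>i<m. c i * z ^ i)"
    using root by (simp add: eq_neg_iff_add_eq_0)
  hence "norm z ^ m = norm (\<Sum>i<m. c i * z ^ i)"
    by (metis norm_minus_cancel norm_power)
  also have "\<dots> \<le> (\<Sum>i<m. norm (c i * z ^ i))" by (rule norm_sum)
  also have "\<dots> \<le> ?S"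
    by (intro sum_mono) (auto simp: norm_mult norm_power intro!: mult_left_le_one_le c)
  also have "\<dots> \<le> (norm z - 1) * ?S"
    using mult_right_mono[OF x, of ?S] by (simp add: sum_nonneg)
  also have "\<dots> = norm z ^ m - 1" by (simp add: power_diff_1_eq)
  finally show False by simp
qed

text \<open>
  Each map \<open>w \<mapsto> A w - \<mu> w\<close> preserves the eigenspaces of every matrix that commutes with \<open>A\<close>;
  the case \<open>c = 0\<close> is that of the kernel.
\<close>

lemma eigenspace_closed_under_commuting_shift:
  fixes A C :: "'a :: field mat"
  assumes A: "A \<in> carrier_mat n n" and C: "C \<in> carrier_mat n n" and comm: "C * A = A * C"
    and w: "w \<in> carrier_vec n" and ev: "C *\<^sub>v w = c \<cdot>\<^sub>v w"
  shows "C *\<^sub>v (A *\<^sub>v w - \<mu> \<cdot>\<^sub>v w) = c \<cdot>\<^sub>v (A *\<^sub>v w - \<mu> \<cdot>\<^sub>v w)"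
proof -
  have Aw: "A *\<^sub>v w \<in> carrier_vec n" using A w by simp
  have "C *\<^sub>v (A *\<^sub>v w) = (C * A) *\<^sub>v w" using A C w by simp
  also have "\<dots> = A *\<^sub>v (C *\<^sub>v w)" unfolding comm using A C w by simp
  also have "\<dots> = c \<cdot>\<^sub>v (A *\<^sub>v w)" unfolding ev by (rule mult_mat_vec[OF A w])
  finally have CA: "C *\<^sub>v (A *\<^sub>v w) = c \<cdot>\<^sub>v (A *\<^sub>v w)" .
  have "C *\<^sub>v (A *\<^sub>v w - \<mu> \<cdot>\<^sub>v w) = C *\<^sub>v (A *\<^sub>v w) - \<mu> \<cdot>\<^sub>v (C *\<^sub>v w)"
    using C Aw w by (simp add: mult_minus_distrib_mat_vec[OF C] mult_mat_vec[OF C])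
  also have "\<dots> = c \<cdot>\<^sub>v (A *\<^sub>v w - \<mu> \<cdot>\<^sub>v w)"
    unfolding CA ev using A w by (intro eq_vecI) (auto simp: right_diff_distrib mult.left_commute simp del: index_mult_mat_vec)
  finally show ?thesis .
qed

text \<open>
  In coordinates \<open>Q w\<close> that make \<open>A\<close> an upper triangular matrix \<open>B\<close>, subtracting the
  diagonal entry \<open>B $$ (k, k)\<close> kills the last of \<open>k + 1\<close> possibly nonzero coordinates. The
  induction is on the number of these coordinates.
\<close>

lemma eigenvector_in_invariant_set:
  fixes A :: "complex mat"
  assumes A: "A \<in> carrier_mat n n"
    and closed: "\<And>w \<mu>. w \<in> carrier_vec n \<Longrightarrow> W w \<Longrightarrow> W (A *\<^sub>v w - \<mu> \<cdot>\<^sub>v w)"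
    and v: "v \<in> carrier_vec n" "v \<noteq> 0\<^sub>v n" "W v"
  obtains w \<mu> where "w \<in> carrier_vec n" "w \<noteq> 0\<^sub>v n" "W w" "A *\<^sub>v w = \<mu> \<cdot>\<^sub>v w"
proof -
  obtain es where "char_poly A = (\<Prod>a\<leftarrow>es. [:- a, 1:])"
    using char_poly_factorized[OF A] by blast
  from schur_decomposition_exists[OF A this]
  obtain B where B: "B \<in> carrier_mat n n" and ut: "upper_triangular B" and "similar_mat A B"
    by blast
  then obtain P Q where wit: "similar_mat_wit A B P Q" unfolding similar_mat_def by blast
  note PQ = similar_mat_witD2[OF A wit]
  have P: "P \<in> carrier_mat n n" and Q: "Q \<in> carrier_mat n n" using PQ by auto
  have "Q * A = Q * (P * B * Q)" using PQ by simp
  also have "\<dots> = (Q * P) * (B * Q)" using P Q B by (simp add: assoc_mult_mat[of _ n n _ n _ n])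
  also have "\<dots> = B * Q" using PQ B Q by simp
  finally have QA: "Q * A = B * Q" .
  have "\<exists>w \<mu>. w \<in> carrier_vec n \<and> w \<noteq> 0\<^sub>v n \<and> W w \<and> A *\<^sub>v w = \<mu> \<cdot>\<^sub>v w"
    if "k \<le> n" "v \<in> carrier_vec n" "v \<noteq> 0\<^sub>v n" "W v" "\<And>i. k \<le> i \<Longrightarrow> i < n \<Longrightarrow> (Q *\<^sub>v v) $ i = 0"
    for k v
    using that
  proof (induction k arbitrary: v)
    case 0
    have "Q *\<^sub>v v = 0\<^sub>v n" using 0 Q by (intro eq_vecI) (auto simp del: index_mult_mat_vec)
    hence "P *\<^sub>v (Q *\<^sub>v v) = 0\<^sub>v n" using P by auto
    moreover have "P *\<^sub>v (Q *\<^sub>v v) = v"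
      using P Q PQ 0 by (simp flip: assoc_mult_mat_vec)
    ultimately show ?case using 0 by simp
  next
    case (Suc k)
    define \<mu> where "\<mu> = B $$ (k, k)"
    define w where "w = A *\<^sub>v v - \<mu> \<cdot>\<^sub>v v"
    have Av: "A *\<^sub>v v \<in> carrier_vec n" using A Suc.prems by simp
    have w: "w \<in> carrier_vec n" "W w"
      using Suc.prems A closed unfolding w_def by auto
    show ?case
    proof (cases "w = 0\<^sub>v n")
      case True
      have "A *\<^sub>v v = \<mu> \<cdot>\<^sub>v v"
      proof (rule eq_vecI)
        fix i assume "i < dim_vec (\<mu> \<cdot>\<^sub>v v)"
        hence i: "i < n" using Suc.prems by simp
        have "w $ i = (A *\<^sub>v v) $ i - (\<mu> \<cdot>\<^sub>v v) $ i"
          using i Suc.prems unfolding w_def by (simp del: index_mult_mat_vec)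
        thus "(A *\<^sub>v v) $ i = (\<mu> \<cdot>\<^sub>v v) $ i"
          using True i by (simp del: index_mult_mat_vec)
      qed (use A Suc.prems in auto)
      thus ?thesis using Suc.prems by blast
    next
      case False
      define y where "y = Q *\<^sub>v v"
      have y: "y \<in> carrier_vec n" "\<And>i. Suc k \<le> i \<Longrightarrow> i < n \<Longrightarrow> y $ i = 0"
        using Q Suc.prems unfolding y_def by (auto simp del: index_mult_mat_vec)
      have "Q *\<^sub>v (A *\<^sub>v v) = B *\<^sub>v y"
        unfolding y_def using QA Q A B Suc.prems by (simp flip: assoc_mult_mat_vec)
      hence Qw: "Q *\<^sub>v w = B *\<^sub>v y - \<mu> \<cdot>\<^sub>v y"
        unfolding w_def using Q Av Suc.prems
        by (simp add: mult_minus_distrib_mat_vec[OF Q] mult_mat_vec[OF Q] y_def)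
      have "(Q *\<^sub>v w) $ i = 0" if i: "k \<le> i" "i < n" for i
      proof -
        have "(B *\<^sub>v y) $ i = (\<Sum>j<n. B $$ (i, j) * y $ j)"
          using B y i by (simp add: scalar_prod_def row_def atLeast0LessThan)
        (* For j < k <= i the entry of B lies below its diagonal; for j > k the coordinate of y is 0. *)
        also have "\<dots> = (\<Sum>j<n. if j = k then B $$ (i, k) * y $ k else 0)"
        proof (rule sum.cong)
          fix j assume j: "j \<in> {..<n}"
          consider "j < k" | "j = k" | "Suc k \<le> j" by linarith
          thus "B $$ (i, j) * y $ j = (if j = k then B $$ (i, k) * y $ k else 0)"
          proof cases
            case 1
            hence "B $$ (i, j) = 0" using ut i B unfolding upper_triangular_def by auto
            thus ?thesis using 1 by simp
          qed (use y j in auto)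
        qed simp
        also have "\<dots> = B $$ (i, k) * y $ k" using Suc.prems by simp
        also have "\<dots> = \<mu> * y $ i"
        proof (cases "i = k")
          case False
          hence "B $$ (i, k) = 0" "y $ i = 0"
            using ut i B y unfolding upper_triangular_def by auto
          thus ?thesis by simp
        qed (simp add: \<mu>_def)
        finally show ?thesis
          unfolding Qw using i y by (simp del: index_mult_mat_vec)
      qed
      thus ?thesis using Suc.IH[of w] Suc.prems w False by simp
    qed
  qed
  from this[of n v] v that show ?thesis by auto
qed

text \<open>
  The eigenspaces of the matrices treated so far are adjoined to \<open>W\<close> one at a time; the result
  stays invariant because the remaining matrices commute with them.
\<close>

lemma commuting_matrices_common_eigenvector:
  fixes A :: "nat \<Rightarrow> complex mat"
  assumes A: "\<And>i. i < m \<Longrightarrow> A i \<in> carrier_mat n n"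
    and comm: "\<And>i j. i < m \<Longrightarrow> j < m \<Longrightarrow> A i * A j = A j * A i"
    and closed: "\<And>i w \<mu>. i < m \<Longrightarrow> w \<in> carrier_vec n \<Longrightarrow> W w \<Longrightarrow> W (A i *\<^sub>v w - \<mu> \<cdot>\<^sub>v w)"
    and v: "v \<in> carrier_vec n" "v \<noteq> 0\<^sub>v n" "W v"
  obtains w c where "w \<in> carrier_vec n" "w \<noteq> 0\<^sub>v n" "W w" "\<And>i. i < m \<Longrightarrow> A i *\<^sub>v w = c i \<cdot>\<^sub>v w"
proof -
  have "\<exists>w c. w \<in> carrier_vec n \<and> w \<noteq> 0\<^sub>v n \<and> W w \<and> (\<forall>i<k. A i *\<^sub>v w = c i \<cdot>\<^sub>v w)"
    if "k \<le> m" for k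
    using that
  proof (induction k)
    case 0
    thus ?case using v by auto
  next
    case (Suc k)
    then obtain w c where w: "w \<in> carrier_vec n" "w \<noteq> 0\<^sub>v n" "W w"
      and c: "\<forall>i<k. A i *\<^sub>v w = c i \<cdot>\<^sub>v w" by auto
    let ?W = "\<lambda>u. W u \<and> (\<forall>i<k. A i *\<^sub>v u = c i \<cdot>\<^sub>v u)"
    have Ak: "A k \<in> carrier_mat n n" using A Suc.prems by simp
    have "?W (A k *\<^sub>v u - \<mu> \<cdot>\<^sub>v u)" if "u \<in> carrier_vec n" "?W u" for u \<mu>
      using that Suc.prems closed[of k u \<mu>] A comm
      by (auto intro!: eigenspace_closed_under_commuting_shift[where n = n])
    from eigenvector_in_invariant_set[where W = ?W, OF Ak this] w c
    obtain u \<mu> where "u \<in> carrier_vec n" "u \<noteq> 0\<^sub>v n" "?W u" "A k *\<^sub>v u = \<mu> \<cdot>\<^sub>v u" by metis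
    thus ?case by (intro exI[of _ u] exI[of _ "c(k := \<mu>)"]) (auto simp: less_Suc_eq)
  qed
  from this[of m] that show ?thesis by auto
qed

lemma index_mult_mat_sum:
  assumes "A \<in> carrier_mat nr n" "B \<in> carrier_mat n nc" "r < nr" "s < nc"
  shows "(A * B) $$ (r, s) = (\<Sum>t<n. A $$ (r, t) * B $$ (t, s))"
  using assms by (simp add: scalar_prod_def atLeast0LessThan)

lemma index_mult_mat_vec_sum:
  assumes "A \<in> carrier_mat nr n" "w \<in> carrier_vec n" "r < nr"
  shows "(A *\<^sub>v w) $ r = (\<Sum>t<n. A $$ (r, t) * w $ t)"
  using assms by (simp add: scalar_prod_def atLeast0LessThan)

lemma matpoly_eval_carrier [simp]: "matpoly_eval n m A z \<in> carrier_mat n n"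
  by (simp add: matpoly_eval_def)

lemma index_matpoly_eval:
  assumes "\<And>i. i \<le> m \<Longrightarrow> A i \<in> carrier_mat n n" "r < n" "t < n"
  shows "matpoly_eval n m A z $$ (r, t) = (\<Sum>i\<le>m. z ^ i * A i $$ (r, t))"
proof -
  have "(z ^ i \<cdot>\<^sub>m A i) $$ (r, t) = z ^ i * A i $$ (r, t)" if "i \<le> m" for i
    using assms(1)[OF that] assms(2,3) by auto
  thus ?thesis unfolding matpoly_eval_def using assms(2,3) by simp
qed

lemma matpoly_eval_commute:
  assumes A: "\<And>i. i \<le> m \<Longrightarrow> A i \<in> carrier_mat n n" and B: "B \<in> carrier_mat n n"
    and comm: "\<And>i. i \<le> m \<Longrightarrow> A i * B = B * A i"
  shows "matpoly_eval n m A z * B = B * matpoly_eval n m A z"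
proof (rule eq_matI)
  fix r s assume "r < dim_row (B * matpoly_eval n m A z)" "s < dim_col (B * matpoly_eval n m A z)"
  hence rs: "r < n" "s < n" using B by (auto simp: matpoly_eval_def)
  have "(matpoly_eval n m A z * B) $$ (r, s)
      = (\<Sum>t<n. (\<Sum>i\<le>m. z ^ i * A i $$ (r, t)) * B $$ (t, s))"
    using rs by (simp add: index_mult_mat_sum[OF matpoly_eval_carrier B] index_matpoly_eval[OF A])
  also have "\<dots> = (\<Sum>i\<le>m. z ^ i * (\<Sum>t<n. A i $$ (r, t) * B $$ (t, s)))"
    unfolding sum_distrib_left sum_distrib_right mult.assoc by (rule sum.swap)
  also have "\<dots> = (\<Sum>i\<le>m. z ^ i * (A i * B) $$ (r, s))"
    using rs by (simp add: index_mult_mat_sum[OF A B] cong: sum.cong_simp)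
  also have "\<dots> = (\<Sum>i\<le>m. z ^ i * (B * A i) $$ (r, s))"
    by (rule sum.cong) (simp_all only: comm atMost_iff)
  also have "\<dots> = (\<Sum>i\<le>m. z ^ i * (\<Sum>t<n. B $$ (r, t) * A i $$ (t, s)))"
    using rs by (simp add: index_mult_mat_sum[OF B A] cong: sum.cong_simp)
  also have "\<dots> = (\<Sum>t<n. B $$ (r, t) * (\<Sum>i\<le>m. z ^ i * A i $$ (t, s)))"
    unfolding sum_distrib_left by (subst sum.swap) (simp add: mult.left_commute)
  also have "\<dots> = (B * matpoly_eval n m A z) $$ (r, s)"
    using rs by (simp add: index_mult_mat_sum[OF B matpoly_eval_carrier] index_matpoly_eval[OF A])
  finally show "(matpoly_eval n m A z * B) $$ (r, s) = (B * matpoly_eval n m A z) $$ (r, s)" .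
qed (use B in \<open>auto simp: matpoly_eval_def\<close>)

lemma matpoly_eval_mult_common_eigenvector:
  assumes A: "\<And>i. i \<le> m \<Longrightarrow> A i \<in> carrier_mat n n" and w: "w \<in> carrier_vec n"
    and ev: "\<And>i. i \<le> m \<Longrightarrow> A i *\<^sub>v w = c i \<cdot>\<^sub>v w"
  shows "matpoly_eval n m A z *\<^sub>v w = (\<Sum>i\<le>m. c i * z ^ i) \<cdot>\<^sub>v w"
proof (rule eq_vecI)
  fix r assume "r < dim_vec ((\<Sum>i\<le>m. c i * z ^ i) \<cdot>\<^sub>v w)"
  hence r: "r < n" using w by simp
  have "(matpoly_eval n m A z *\<^sub>v w) $ r = (\<Sum>t<n. (\<Sum>i\<le>m. z ^ i * A i $$ (r, t)) * w $ t)"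
    using r by (simp add: index_mult_mat_vec_sum[OF matpoly_eval_carrier w] index_matpoly_eval[OF A]
        del: index_mult_mat_vec)
  also have "\<dots> = (\<Sum>i\<le>m. z ^ i * (\<Sum>t<n. A i $$ (r, t) * w $ t))"
    unfolding sum_distrib_left sum_distrib_right mult.assoc by (rule sum.swap)
  also have "\<dots> = (\<Sum>i\<le>m. z ^ i * (A i *\<^sub>v w) $ r)"
    using r by (simp add: index_mult_mat_vec_sum[OF A w] del: index_mult_mat_vec cong: sum.cong_simp)
  also have "\<dots> = (\<Sum>i\<le>m. z ^ i * (c i * w $ r))"
    using ev w r by (simp del: index_mult_mat_vec)
  also have "\<dots> = ((\<Sum>i\<le>m. c i * z ^ i) \<cdot>\<^sub>v w) $ r"
    using w r by (simp add: sum_distrib_left sum_distrib_right mult_ac)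
  finally show "(matpoly_eval n m A z *\<^sub>v w) $ r = ((\<Sum>i\<le>m. c i * z ^ i) \<cdot>\<^sub>v w) $ r" .
qed (use w in \<open>auto simp: matpoly_eval_def\<close>)

theorem corollary2p7:
  fixes m n :: nat and A :: "nat \<Rightarrow> complex mat" and z\<^sub>0 :: complex
  assumes "m \<ge> 1" and "n \<ge> 1"
    and "\<And>i. i < m \<Longrightarrow> A i \<in> carrier_mat n n"
    and "\<And>i. i < m \<Longrightarrow> schur_stable (A i)"
    and "\<And>i j. i < m \<Longrightarrow> j < m \<Longrightarrow> A i * A j = A j * A i"
    and "A m = 1\<^sub>m n"
    and "matpoly_eigenvalue n m A z\<^sub>0"
  shows "cmod z\<^sub>0 < 2"
proof -
  let ?P = "matpoly_eval n m A z\<^sub>0"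
  have A: "A i \<in> carrier_mat n n" if "i \<le> m" for i
    using that assms(3)[of i] assms(6) by (cases "i = m") auto
  have comm: "A i * A j = A j * A i" if "i \<le> m" "j < m" for i j
    using that assms(3)[of j] assms(5)[of i j] assms(6) by (cases "i = m") auto
  have zero: "(0 :: complex) \<cdot>\<^sub>v v = 0\<^sub>v n" if "v \<in> carrier_vec n" for v
    using that by (intro eq_vecI) auto
  obtain v where v: "v \<in> carrier_vec n" "v \<noteq> 0\<^sub>v n" "?P *\<^sub>v v = 0 \<cdot>\<^sub>v v"
    using assms(7) zero unfolding matpoly_eigenvalue_def by metis
  have P_commute: "?P * A j = A j * ?P" if "j < m" for j
    using that A comm by (intro matpoly_eval_commute) auto
  obtain w c where w: "w \<in> carrier_vec n" "w \<noteq> 0\<^sub>v n" "?P *\<^sub>v w = 0 \<cdot>\<^sub>v w"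
    and c: "\<And>i. i < m \<Longrightarrow> A i *\<^sub>v w = c i \<cdot>\<^sub>v w"
  proof (rule commuting_matrices_common_eigenvector
      [where W = "\<lambda>w. ?P *\<^sub>v w = 0 \<cdot>\<^sub>v w" and m = m and A = A and n = n and v = v])
    fix i u \<mu> assume "i < m" "u \<in> carrier_vec n" "?P *\<^sub>v u = 0 \<cdot>\<^sub>v u"
    thus "?P *\<^sub>v (A i *\<^sub>v u - \<mu> \<cdot>\<^sub>v u) = 0 \<cdot>\<^sub>v (A i *\<^sub>v u - \<mu> \<cdot>\<^sub>v u)"
      by (intro eigenspace_closed_under_commuting_shift[where n = n]) (auto intro: A P_commute)
  qed (use A comm v that in auto)
  \<comment> \<open>The leading coefficient is the identity, so its eigenvalue at \<open>w\<close> is 1.\<close>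
  define d where "d = c(m := 1)"
  have d: "A i *\<^sub>v w = d i \<cdot>\<^sub>v w" if "i \<le> m" for i
    using that c[of i] assms(6) w(1) by (cases "i = m") (auto simp: d_def)
  have "(\<Sum>i\<le>m. d i * z\<^sub>0 ^ i) \<cdot>\<^sub>v w = 0\<^sub>v n"
    using matpoly_eval_mult_common_eigenvector[of m A n w d z\<^sub>0] A d w zero by simp
  moreover obtain r where r: "r < n" "w $ r \<noteq> 0"
    using w(1,2) by (metis carrier_vecD eq_vecI index_zero_vec)
  ultimately have "(\<Sum>i\<le>m. d i * z\<^sub>0 ^ i) * w $ r = 0"
    using w(1) by (metis carrier_vecD index_smult_vec(1) index_zero_vec(1))
  hence "(\<Sum>i\<le>m. d i * z\<^sub>0 ^ i) = 0" using r by simp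
  hence "z\<^sub>0 ^ m + (\<Sum>i<m. c i * z\<^sub>0 ^ i) = 0"
    by (simp add: d_def flip: lessThan_Suc_atMost add: add.commute)
  moreover have "norm (c i) \<le> 1" if i: "i < m" for i
  proof -
    have "eigenvalue (A i) (c i)"
      using assms(3)[OF i] w c[OF i] unfolding eigenvalue_def eigenvector_def by auto
    thus ?thesis using assms(4)[OF i] unfolding schur_stable_def by force
  qed
  ultimately show ?thesis by (rule monic_root_norm_less_2)
qed

end
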